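(* Let $(\alpha,\beta)\in\mathcal I$ and $t\in[\alpha,\beta]$. Let $(\tilde\alpha_j,\tilde\beta_j)\in\mathcal I$, $j=1,\dots,M$, $M\in\mathbb N\cup\{\infty\}$, be all the intervals of $\mathcal I$ with $\tilde\alpha_j<\alpha$. Then, almost surely, $$Y(t)=Y_0+\int_0^t\Big(\frac{k}{Y(s)}-aY(s)\Big)ds+\sigma\Big(B^H(\beta_0)+\sum_{j=1}^M\big(B^H(\tilde\beta_j)-B^H(\tilde\alpha_j)\big)+\big(B^H(t)-B^H(\alpha)\big)\Big).$$
   Context: $B^H=\{B^H(t),t\ge0\}$ is a fractional Brownian motion with Hurst index $H\in(0,1/2)$ on a probability space $(\Omega,\mathcal F,\mathbb P)$, i.e. a centered Gaussian process with covariance $\mathbb E[B^H(t)B^H(s)]=\frac12(t^{2H}+s^{2H}-|t-s|^{2H})$ and continuous paths starting at $0$. $Y_0,k,a,\sigma>0$ are constants. For $\varepsilon>0$, $Y_\varepsilon=\{Y_\varepsilon(t),t\ge0\}$ is the unique (pathwise, continuous) solution of $$Y_\varepsilon(t)=Y_0+\int_0^t\frac{k}{Y_\varepsilon(s)\mathbf 1_{\{Y_\varepsilon(s)>0\}}+\varepsilon}\,ds-a\int_0^tY_\varepsilon(s)\,ds+\sigma B^H(t),\quad t\ge0.$$ $Y_\varepsilon(t)$ increases as $\varepsilon$ decreases, and $Y(t)=\lim_{\varepsilon\downarrow0}Y_\varepsilon(t)$, $t\ge0$, is the pointwise limit. Only finite and locally Lebesgue integrable paths of $Y$ are considered (this excludes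 only a null set). Almost surely $Y\ge0$, $Y>0$ a.e., and the set $\{t>0\mid Y(t)>0\}$ is open in $\mathbb R$; hence the positivity set is a.s. represented as $$\{t\ge0\mid Y(t)>0\}=[\alpha_0,\beta_0)\cup\Big(\bigcup_{i=1}^N(\alpha_i,\beta_i)\Big),\qquad N\in\mathbb N\cup\{\infty\},$$ where $\alpha_0=0$, $\beta_0$ is the first moment at which $Y$ hits zero, and the (random, pathwise defined) intervals $(\alpha_i,\beta_i)$, $i\ge1$, are pairwise disjoint and disjoint from $[\alpha_0,\beta_0)$ (they are the connected components of the positivity set). The endpoints are treated as real (finite) numbers. $\mathcal I=\{(\alpha_i,\beta_i),\ i=1,\dots,N\}$ is the set of these open intervals (it does not contain $[0,\beta_0)$). The sum over $j$ is zero if there are no such intervals. *)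

theory Defs
  imports "HOL-Probability.Probability"
begin

(* Degenerate (constant) Gaussian variables are allowed: s = 0 is the Dirac mass at m. *)
definition gaussian_rv :: "'a measure \<Rightarrow> ('a \<Rightarrow> real) \<Rightarrow> bool" where
  "gaussian_rv M X \<longleftrightarrow> X \<in> borel_measurable M \<and>
     (\<exists>m s. 0 \<le> s \<and>
        distr M borel X =
          (if s = 0 then return borel m
           else density lborel (\<lambda>x. ennreal (normal_density m s x))))"

definition gaussian_process :: "'a measure \<Rightarrow> (real \<Rightarrow> 'a \<Rightarrow> real) \<Rightarrow> bool" where
  "gaussian_process M B \<longleftrightarrow>
     (\<forall>F c. finite F \<and> F \<subseteq> {0..} \<longrightarrow> gaussian_rv M (\<lambda>\<omega>. \<Sum>t\<in>F. c t * B t \<omega>))"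

definition fractional_brownian_motion ::
    "'a measure \<Rightarrow> real \<Rightarrow> (real \<Rightarrow> 'a \<Rightarrow> real) \<Rightarrow> bool" where
  "fractional_brownian_motion M H B \<longleftrightarrow>
     gaussian_process M B \<and>
     (\<forall>t\<ge>0. (\<integral>\<omega>. B t \<omega> \<partial>M) = 0) \<and>
     (\<forall>t\<ge>0. \<forall>s\<ge>0. (\<integral>\<omega>. B t \<omega> * B s \<omega> \<partial>M) =
        1/2 * (t powr (2*H) + s powr (2*H) - \<bar>t - s\<bar> powr (2*H))) \<and>
     (\<forall>\<omega>\<in>space M. B 0 \<omega> = 0 \<and> continuous_on {0..} (\<lambda>t. B t \<omega>))"

(* y is a continuous solution of the regularised equation driven by the path b. *)
definition solves_approx ::
    "real \<Rightarrow> real \<Rightarrow> real \<Rightarrow> real \<Rightarrow> (real \<Rightarrow> real) \<Rightarrow> real \<Rightarrow> (real \<Rightarrow> real) \<Rightarrow> bool" where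
  "solves_approx Y0 k a \<sigma> b \<epsilon> y \<longleftrightarrow>
     continuous_on {0..} y \<and>
     (\<forall>t\<ge>0. y t = Y0
        + (LBINT s:{0..t}. k / (y s * indicator {0<..} (y s) + \<epsilon>))
        - a * (LBINT s:{0..t}. y s) + \<sigma> * b t)"

definition limit_process :: "(real \<Rightarrow> real \<Rightarrow> 'a \<Rightarrow> real) \<Rightarrow> real \<Rightarrow> 'a \<Rightarrow> real" where
  "limit_process Ye t \<omega> = Lim (at_right 0) (\<lambda>\<epsilon>. Ye \<epsilon> t \<omega>)"

definition positivity_set :: "(real \<Rightarrow> real) \<Rightarrow> real set" where
  "positivity_set y = {t. 0 \<le> t \<and> 0 < y t}"

definition first_zero :: "(real \<Rightarrow> real) \<Rightarrow> real" where
  "first_zero y = Inf {t. 0 \<le> t \<and> y t = 0}"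

(* When y 0 > 0, the component [0, first_zero y) contains 0 and is therefore not of
   the form {\<alpha><..<\<beta>} (which would contain negative numbers): it is excluded. *)
definition excursions :: "(real \<Rightarrow> real) \<Rightarrow> (real \<times> real) set" where
  "excursions y = {(\<alpha>, \<beta>). \<alpha> < \<beta> \<and> {\<alpha><..<\<beta>} \<in> components (positivity_set y)}"

end

theory Submission
  imports Defs
begin

text \<open>
  The statement holds for every path. The last time before \<open>s\<close> at which \<open>Y\<^sub>\<epsilon>\<close> crosses a level
  \<open>c > 0\<close> bounds the singular drift by \<open>k / c\<close> from there on, so \<open>Y\<^sub>\<epsilon>\<close> can only rise from \<open>c\<close>
  by a small amount in a short time, uniformly in \<open>\<epsilon>\<close>. Hence the increasing limit \<open>Y\<close> is finite
  and continuous; it is nonnegative because the drift \<open>k / \<epsilon>\<close> below zero blows up. The integrals of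
  the singular drifts are bounded, so by Fatou's lemma \<open>k / Y\<close> is locally integrable and \<open>Y > 0\<close>
  almost everywhere. By monotonicity and compactness, \<open>Y\<^sub>\<epsilon>\<close> is bounded away from zero for small \<open>\<epsilon>\<close>
  on compact intervals where \<open>Y > 0\<close>; thus the limit equation holds there and, by continuity, on
  closed excursion intervals. On each earlier excursion \<open>Y\<close> vanishes at both ends, so the increment
  of \<open>\<sigma> B\<close> is minus the integral of \<open>k / Y - a Y\<close>; countable additivity over \<open>{Y > 0}\<close>, which has
  full measure, gives both summability and the formula.
\<close>

section \<open>Sign changes and countable additivity\<close>

lemma Ioo_eq_iff:
  fixes a b c d :: real
  assumes "a < b" "c < d"
  shows "{a<..<b} = {c<..<d} \<longleftrightarrow> a = c \<and> b = d"
  using assms by (auto simp: set_eq_subset greaterThanLessThan_subseteq_greaterThanLessThan)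

text \<open>The level set is compact and, by the intermediate value theorem, nonempty, so it has a
  greatest element; a later dip below \<open>c\<close> would force a crossing after it. Used to
  start estimates at a time after which the drift is under control.\<close>

lemma last_crossing:
  fixes f :: "real \<Rightarrow> real"
  assumes f: "continuous_on {r..s} f" and "r \<le> s" "f r \<le> c" "c \<le> f s"
  obtains u where "r \<le> u" "u \<le> s" "f u = c" "\<And>v. u \<le> v \<Longrightarrow> v \<le> s \<Longrightarrow> c \<le> f v"
proof -
  define Z where "Z = {x \<in> {r..s}. f x = c}"
  have "closed Z"
    unfolding Z_def by (rule continuous_closed_preimage_constant) (use f in auto)
  moreover have "bounded Z"
    by (rule bounded_subset[OF bounded_closed_interval[of r s]]) (auto simp: Z_def)
  moreover have "Z \<noteq> {}"
    using IVT'[of f r c s] assms by (auto simp: Z_def)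
  ultimately obtain u where u: "u \<in> Z" "\<And>v. v \<in> Z \<Longrightarrow> v \<le> u"
    using compact_attains_sup[of Z] by (auto simp: compact_eq_bounded_closed)
  have "c \<le> f v" if v: "u \<le> v" "v \<le> s" for v
  proof (rule ccontr)
    assume "\<not> c \<le> f v"
    moreover have "continuous_on {v..s} f"
      by (rule continuous_on_subset[OF f]) (use u(1) v in \<open>auto simp: Z_def\<close>)
    ultimately obtain w where "v \<le> w" "w \<le> s" "f w = c"
      using IVT'[of f v c s] v assms by auto
    then have "w \<le> u" and "f w = c"
      using u v by (auto simp: Z_def)
    with \<open>v \<le> w\<close> v have "w = v" by linarith
    with \<open>f w = c\<close> \<open>\<not> c \<le> f v\<close> show False by simp
  qed
  with u(1) show thesis
    by (intro that) (auto simp: Z_def)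
qed

text \<open>Compactness of the zero set on both sides of \<open>x\<close> gives a last zero before
  \<open>x\<close> and a first zero after it.\<close>

lemma zeros_around:
  fixes f :: "real \<Rightarrow> real"
  assumes f: "continuous_on {p..q} f" and "f p = 0" "f q = 0" "p \<le> x" "x \<le> q" "f x \<noteq> 0"
  obtains u v where "p \<le> u" "u < x" "x < v" "v \<le> q" "f u = 0" "f v = 0"
    "\<And>w. u < w \<Longrightarrow> w < v \<Longrightarrow> f w \<noteq> 0"
proof -
  have comp: "compact {w \<in> {l..r}. f w = 0}" if "p \<le> l" "r \<le> q" for l r
  proof -
    have "closed {w \<in> {l..r}. f w = 0}"
      by (rule continuous_closed_preimage_constant)
         (use f that in \<open>auto intro: continuous_on_subset\<close>)
    moreover have "bounded {w \<in> {l..r}. f w = 0}"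
      by (rule bounded_subset[OF bounded_closed_interval[of l r]]) auto
    ultimately show ?thesis by (simp add: compact_eq_bounded_closed)
  qed
  obtain u where u: "u \<in> {w \<in> {p..x}. f w = 0}" "\<And>w. w \<in> {w \<in> {p..x}. f w = 0} \<Longrightarrow> w \<le> u"
    using compact_attains_sup[OF comp[of p x]] assms that
    by (metis (mono_tags, lifting) atLeastAtMost_iff empty_iff mem_Collect_eq order_refl)
  obtain v where v: "v \<in> {w \<in> {x..q}. f w = 0}" "\<And>w. w \<in> {w \<in> {x..q}. f w = 0} \<Longrightarrow> v \<le> w"
    using compact_attains_inf[OF comp[of x q]] assms that
    by (metis (mono_tags, lifting) atLeastAtMost_iff empty_iff mem_Collect_eq order_refl)
  show thesis
  proof (rule that[of u v])
    fix w assume w: "u < w" "w < v"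
    show "f w \<noteq> 0"
    proof
      assume "f w = 0"
      show False
        using u(2)[of w] v(2)[of w] w u(1) v(1) \<open>f w = 0\<close> by (cases "w \<le> x") auto
    qed
  qed (use u(1) v(1) assms in \<open>auto simp: less_le\<close>)
qed

text \<open>Countable additivity as an unordered sum: integrability of the norm of \<open>f\<close>
  gives absolute convergence, which makes the order of the pieces irrelevant.\<close>

lemma has_sum_set_integral:
  fixes f :: "'a \<Rightarrow> real"
  assumes "countable J" and disj: "disjoint_family_on A J"
    and meas: "\<And>j. j \<in> J \<Longrightarrow> A j \<in> sets M"
    and int: "set_integrable M (\<Union>j\<in>J. A j) f"
  shows "((\<lambda>j. LINT x:A j|M. f x) has_sum (LINT x:(\<Union>j\<in>J. A j)|M. f x)) J"
proof -
  define e where "e = to_nat_on J"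
  have inj: "inj_on e J"
    unfolding e_def using \<open>countable J\<close> by (rule inj_on_to_nat_on)
  \<comment> \<open>The pieces are enumerated along the injection \<open>e\<close>; numbers outside
    its range get the empty set and contribute zero.\<close>
  define A' where "A' n = (if n \<in> e ` J then A (the_inv_into J e n) else {})" for n
  have A'_e: "A' (e j) = A j" if "j \<in> J" for j
    using that by (simp add: A'_def the_inv_into_f_f[OF inj])
  have Un: "(\<Union>n. A' n) = (\<Union>j\<in>J. A j)"
  proof -
    have "(\<Union>n. A' n) = (\<Union>n\<in>e ` J. A' n)"
      by (auto simp: A'_def split: if_splits)
    also have "\<dots> = (\<Union>j\<in>J. A j)"
      using A'_e by auto
    finally show ?thesis .
  qed
  have m': "A' n \<in> sets M" for n
    using meas A'_e by (cases "n \<in> e ` J") (auto simp: A'_def the_inv_into_f_f[OF inj])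
  have d': "A' m \<inter> A' n = {}" if "m \<noteq> n" for m n
    using disj that by (auto simp: A'_def disjoint_family_on_def the_inv_into_f_f[OF inj] split: if_splits)
      (metis IntI emptyE)
  have disj': "disjoint_family A'"
    using d' by (auto simp: disjoint_family_on_def)
  \<comment> \<open>Stated for arbitrary \<open>g\<close>, since it is applied both to
    \<open>f\<close> and to its norm.\<close>
  have sums: "(\<lambda>n. LINT x:A' n|M. g x) sums (LINT x:(\<Union>n. A' n)|M. g x)"
    if g: "set_integrable M (\<Union>n. A' n) g" for g :: "'a \<Rightarrow> real"
  proof -
    have "(\<lambda>n. (LINT x:(\<Union>i<n. A' i)|M. g x)) \<longlonglongrightarrow> (LINT x:(\<Union>n. \<Union>i<n. A' i)|M. g x)"
    proof (rule set_integral_cont_up)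
      show "incseq (\<lambda>n. \<Union>i<n. A' i)" by (force simp: incseq_def)
      have "(\<Union>n. \<Union>i<n. A' i) = (\<Union>n. A' n)" by auto
      with g show "set_integrable M (\<Union>n. \<Union>i<n. A' i) g" by simp
    qed (use m' in auto)
    moreover have "(LINT x:(\<Union>i<n. A' i)|M. g x) = (\<Sum>i<n. LINT x:A' i|M. g x)" for n
    proof (rule set_integral_finite_Union)
      show "disjoint_family_on A' {..<n}" 
        using disj' by (auto simp: disjoint_family_on_def)
      show "set_integrable M (A' i) g" if "i \<in> {..<n}" for i
        by (rule set_integrable_subset[OF g]) (use m' in auto)
    qed (use m' in auto)
    moreover have "(\<Union>n. \<Union>i<n. A' i) = (\<Union>n. A' n)" by auto
    ultimately show ?thesis by (simp add: sums_def)
  qed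
  have "summable (\<lambda>n. norm (LINT x:A' n|M. f x))"
  proof (rule summable_comparison_test)
    show "summable (\<lambda>n. LINT x:A' n|M. norm (f x))"
      using sums[OF set_integrable_norm[OF int[folded Un]]] by (rule sums_summable)
    show "\<exists>N. \<forall>n\<ge>N. norm (norm (LINT x:A' n|M. f x)) \<le> (LINT x:A' n|M. norm (f x))"
    proof (intro exI allI impI)
      fix n
      have "set_integrable M (A' n) f"
        by (rule set_integrable_subset[OF int[folded Un]]) (use m' in auto)
      from set_integral_norm_bound[OF this] show "norm (norm (LINT x:A' n|M. f x)) \<le> (LINT x:A' n|M. norm (f x))"
        by simp
    qed
  qed
  then have "((\<lambda>n. LINT x:A' n|M. f x) has_sum (LINT x:(\<Union>n. A' n)|M. f x)) UNIV"
    by (rule norm_summable_imp_has_sum) (rule sums[OF int[folded Un]])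
  also have "?this \<longleftrightarrow> ((\<lambda>n. LINT x:A' n|M. f x) has_sum (LINT x:(\<Union>n. A' n)|M. f x)) (e ` J)"
    by (rule has_sum_cong_neutral) (auto simp: A'_def set_lebesgue_integral_def)
  also have "\<dots> \<longleftrightarrow> ((\<lambda>j. LINT x:A' (e j)|M. f x) has_sum (LINT x:(\<Union>n. A' n)|M. f x)) J"
    by (simp add: has_sum_reindex[OF inj] o_def)
  also have "\<dots> \<longleftrightarrow> ((\<lambda>j. LINT x:A j|M. f x) has_sum (LINT x:(\<Union>n. A' n)|M. f x)) J"
    by (rule has_sum_cong) (simp add: A'_e)
  finally show ?thesis by (simp add: Un)
qed

section \<open>Excursions\<close>

text \<open>Maximality of components: if \<open>y\<close> were positive at an endpoint, adjoining
  that point would give a larger connected subset of the positivity set.\<close>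

lemma excursion_endpoints:
  assumes "(\<alpha>, \<beta>) \<in> excursions y" and "0 < y 0"
  shows "0 < \<alpha>" "\<alpha> < \<beta>" "y \<alpha> \<le> 0" "y \<beta> \<le> 0" "\<And>x. \<alpha> < x \<Longrightarrow> x < \<beta> \<Longrightarrow> 0 < y x"
proof -
  have lt: "\<alpha> < \<beta>" and comp: "{\<alpha><..<\<beta>} \<in> components (positivity_set y)"
    using assms by (auto simp: excursions_def)
  have sub: "{\<alpha><..<\<beta>} \<subseteq> positivity_set y"
    using comp in_components_subset by blast
  have pos: "0 \<le> x \<and> 0 < y x" if "\<alpha> < x" "x < \<beta>" for x
    using sub that by (auto simp: positivity_set_def)
  have a0: "0 \<le> \<alpha>"
  proof (rule ccontr)
    assume "\<not> 0 \<le> \<alpha>"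
    then obtain x where "\<alpha> < x" "x < min 0 \<beta>"
      using lt dense[of \<alpha> "min 0 \<beta>"] by auto
    then show False
      using pos[of x] by simp
  qed
  obtain m where m: "\<alpha> < m" "m < \<beta>" using lt dense by blast
  have max: "T \<subseteq> {\<alpha><..<\<beta>}" if "connected T" "T \<subseteq> positivity_set y" "m \<in> T" for T
    using components_maximal[OF comp that(1,2)] that(3) m by fastforce
  show ya: "y \<alpha> \<le> 0"
  proof (rule ccontr)
    assume "\<not> y \<alpha> \<le> 0"
    then have "x \<in> positivity_set y" if "x \<in> {\<alpha>..<\<beta>}" for x
      using pos[of x] a0 lt that by (cases "x = \<alpha>") (auto simp: positivity_set_def)
    then have "{\<alpha>..<\<beta>} \<subseteq> {\<alpha><..<\<beta>}"
      using m by (intro max) auto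
    with lt show False by auto
  qed
  show "y \<beta> \<le> 0"
  proof (rule ccontr)
    assume "\<not> y \<beta> \<le> 0"
    then have "x \<in> positivity_set y" if "x \<in> {\<alpha><..\<beta>}" for x
      using pos[of x] a0 lt that by (cases "x = \<beta>") (auto simp: positivity_set_def)
    then have "{\<alpha><..\<beta>} \<subseteq> {\<alpha><..<\<beta>}"
      using m by (intro max) auto
    with lt show False by auto
  qed
  show "0 < \<alpha>"
    using a0 ya assms(2) by (cases "\<alpha> = 0") auto
  show "\<alpha> < \<beta>" by fact
  show "\<And>x. \<alpha> < x \<Longrightarrow> x < \<beta> \<Longrightarrow> 0 < y x" using pos by blast
qed

text \<open>A connected set of reals is an interval, so a connected superset inside the positivity
  set cannot grow past the excluded endpoints.\<close>

lemma excursionI: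
  assumes "0 \<le> \<alpha>" "\<alpha> < \<beta>" "y \<alpha> \<le> 0" "y \<beta> \<le> 0"
    and pos: "\<And>x. \<alpha> < x \<Longrightarrow> x < \<beta> \<Longrightarrow> 0 < y x"
  shows "(\<alpha>, \<beta>) \<in> excursions y"
proof -
  have "D = {\<alpha><..<\<beta>}" if D: "{\<alpha><..<\<beta>} \<subseteq> D" "D \<subseteq> positivity_set y" "connected D" for D
  proof -
    have "is_interval D" using D(3) by (simp add: is_interval_connected_1)
    obtain m where m: "\<alpha> < m" "m < \<beta>" using \<open>\<alpha> < \<beta>\<close> dense by blast
    with D have "m \<in> D" by auto
    have ends: "\<alpha> \<notin> D" "\<beta> \<notin> D" using D(2) assms by (auto simp: positivity_set_def)
    have "\<alpha> < x \<and> x < \<beta>" if "x \<in> D" for x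
      using \<open>is_interval D\<close>[unfolded is_interval_1] ends m \<open>m \<in> D\<close> that
      by (meson less_imp_le not_le)
    with D show ?thesis by auto
  qed
  then have "{\<alpha><..<\<beta>} \<in> components (positivity_set y)"
    using assms by (auto simp: in_components_maximal positivity_set_def)
  with \<open>\<alpha> < \<beta>\<close> show ?thesis by (simp add: excursions_def)
qed

lemma excursions_disjoint:
  "disjoint_family_on (\<lambda>(\<alpha>, \<beta>). {\<alpha><..<\<beta>}) (excursions y)"
proof -
  have "{\<alpha><..<\<beta>} \<inter> {\<alpha>'<..<\<beta>'} = {}"
    if "(\<alpha>, \<beta>) \<in> excursions y" "(\<alpha>', \<beta>') \<in> excursions y" "(\<alpha>, \<beta>) \<noteq> (\<alpha>', \<beta>')" for \<alpha> \<beta> \<alpha>' \<beta>'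
  proof -
    have "{\<alpha><..<\<beta>} \<noteq> {\<alpha>'<..<\<beta>'}"
      using that by (auto simp: excursions_def Ioo_eq_iff)
    moreover have "{\<alpha><..<\<beta>} \<in> components (positivity_set y)" "{\<alpha>'<..<\<beta>'} \<in> components (positivity_set y)"
      using that by (simp_all add: excursions_def)
    ultimately show ?thesis
      using components_nonoverlap by metis
  qed
  then have "(case I of (\<alpha>, \<beta>) \<Rightarrow> {\<alpha><..<\<beta>}) \<inter> (case I' of (\<alpha>, \<beta>) \<Rightarrow> {\<alpha><..<\<beta>}) = {}"
    if "I \<in> excursions y" "I' \<in> excursions y" "I \<noteq> I'" for I I'
    using that by (cases I; cases I') blast
  then show ?thesis
    unfolding disjoint_family_on_def by blast
qed

text \<open>Disjoint open subsets of the line are countable in number, and a nonempty open interval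
  determines its endpoints.\<close>

lemma countable_excursions: "countable (excursions y)"
proof -
  let ?I = "\<lambda>(\<alpha>::real, \<beta>). {\<alpha><..<\<beta>}"
  have inj: "inj_on ?I (excursions y)"
    by (auto simp: inj_on_def excursions_def Ioo_eq_iff)
  have "countable (?I ` excursions y)"
  proof (rule countable_disjoint_open_subsets)
    show "pairwise disjnt (?I ` excursions y)"
      using pairwise_disjoint_components[of "positivity_set y"]
      by (rule pairwise_mono) (auto simp: excursions_def disjnt_def)
  qed auto
  then show ?thesis
    using inj by (rule countable_image_inj_on)
qed

section \<open>The limit of the regularised equations\<close>

text \<open>One fixed sample path: \<open>b\<close> stands for the driving noise and
  \<open>ye \<epsilon>\<close> for the regularised solution at a single sample point.\<close>

locale singular_limit =
  fixes Y0 k a \<sigma> :: real and b :: "real \<Rightarrow> real" and ye :: "real \<Rightarrow> real \<Rightarrow> real"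
  assumes Y0_pos: "0 < Y0" and k_pos: "0 < k" and a_pos: "0 < a" and \<sigma>_pos: "0 < \<sigma>"
    and b_0: "b 0 = 0" and b_cont: "continuous_on {0..} b"
    and solves: "\<And>\<epsilon>. 0 < \<epsilon> \<Longrightarrow> solves_approx Y0 k a \<sigma> b \<epsilon> (ye \<epsilon>)"
begin

text \<open>\<open>max x 0\<close> is \<open>x * indicator {0<..} x\<close> in a form whose
  continuity and monotonicity are visible.\<close>

definition drift :: "real \<Rightarrow> real \<Rightarrow> real" where
  "drift \<epsilon> x = k / (max x 0 + \<epsilon>) - a * x"

definition y :: "real \<Rightarrow> real" where
  "y t = Lim (at_right 0) (\<lambda>\<epsilon>. ye \<epsilon> t)"

lemma ye_cont: "0 < \<epsilon> \<Longrightarrow> S \<subseteq> {0..} \<Longrightarrow> continuous_on S (ye \<epsilon>)"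
  using solves by (auto simp: solves_approx_def intro: continuous_on_subset)

lemma b_cont': "S \<subseteq> {0..} \<Longrightarrow> continuous_on S b"
  using b_cont continuous_on_subset by blast

lemma singular_cont:
  "0 < \<epsilon> \<Longrightarrow> S \<subseteq> {0..} \<Longrightarrow> continuous_on S (\<lambda>u. k / (max (ye \<epsilon> u) 0 + \<epsilon>))"
  by (intro continuous_intros ye_cont) (auto simp: max_def add_nonneg_eq_0_iff)

lemma drift_cont: "0 < \<epsilon> \<Longrightarrow> S \<subseteq> {0..} \<Longrightarrow> continuous_on S (\<lambda>u. drift \<epsilon> (ye \<epsilon> u))"
  unfolding drift_def by (intro continuous_intros singular_cont ye_cont)

lemma drift_integrable: "0 < \<epsilon> \<Longrightarrow> 0 \<le> r \<Longrightarrow> (\<lambda>u. drift \<epsilon> (ye \<epsilon> u)) integrable_on {r..s}"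
  by (rule integrable_continuous_interval) (auto intro: drift_cont)

text \<open>Passes from Lebesgue set integrals to \<open>integral\<close> and merges the two drift
  terms into one.\<close>

lemma ye_eq_0:
  assumes "0 < \<epsilon>" "0 \<le> t"
  shows "ye \<epsilon> t = Y0 + integral {0..t} (\<lambda>u. drift \<epsilon> (ye \<epsilon> u)) + \<sigma> * b t"
proof -
  have max: "x * indicator {0<..} x = max x 0" for x :: real
    by (auto simp: indicator_def max_def)
  have int1: "set_integrable lborel {0..t} (\<lambda>u. k / (max (ye \<epsilon> u) 0 + \<epsilon>))"
    by (rule borel_integrable_atLeastAtMost') (use assms in \<open>auto intro: singular_cont\<close>)
  have int2: "set_integrable lborel {0..t} (ye \<epsilon>)"
    by (rule borel_integrable_atLeastAtMost') (use assms in \<open>auto intro: ye_cont\<close>)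
  have "ye \<epsilon> t = Y0 + integral {0..t} (\<lambda>u. k / (max (ye \<epsilon> u) 0 + \<epsilon>))
      - a * integral {0..t} (ye \<epsilon>) + \<sigma> * b t"
    using solves[OF assms(1)] assms(2) 
    by (simp add: solves_approx_def max set_borel_integral_eq_integral(2)[OF int1]
        set_borel_integral_eq_integral(2)[OF int2])
  moreover have "integral {0..t} (\<lambda>u. k / (max (ye \<epsilon> u) 0 + \<epsilon>)) - a * integral {0..t} (ye \<epsilon>) =
      integral {0..t} (\<lambda>u. drift \<epsilon> (ye \<epsilon> u))"
    unfolding drift_def
    using set_borel_integral_eq_integral(1)[OF int1] set_borel_integral_eq_integral(1)[OF int2]
    by (subst Henstock_Kurzweil_Integration.integral_diff) (auto intro: integrable_on_mult_right)
  ultimately show ?thesis by simp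
qed

lemma ye_0: "0 < \<epsilon> \<Longrightarrow> ye \<epsilon> 0 = Y0"
  using ye_eq_0[of \<epsilon> 0] b_0 by simp

lemma ye_increment:
  assumes "0 < \<epsilon>" "0 \<le> r" "r \<le> s"
  shows "ye \<epsilon> s = ye \<epsilon> r + integral {r..s} (\<lambda>u. drift \<epsilon> (ye \<epsilon> u)) + \<sigma> * (b s - b r)"
  using ye_eq_0[of \<epsilon> r] ye_eq_0[of \<epsilon> s] assms
    Henstock_Kurzweil_Integration.integral_combine[of 0 r s "\<lambda>u. drift \<epsilon> (ye \<epsilon> u)"]
  by (simp add: drift_integrable algebra_simps)

section \<open>Comparison in \<epsilon> and bounds uniform in \<epsilon>\<close>

lemma drift_le:
  assumes "0 < \<epsilon>" "0 < c" "c \<le> x"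
  shows "drift \<epsilon> x \<le> k / c"
proof -
  have "k / (max x 0 + \<epsilon>) \<le> k / c"
    using assms k_pos by (intro divide_left_mono mult_pos_pos) auto
  moreover have "0 \<le> a * x" using assms a_pos by simp
  ultimately show ?thesis by (simp add: drift_def)
qed

lemma drift_mono:
  assumes "0 < \<epsilon>" "\<epsilon> \<le> \<epsilon>'" "x \<le> x'"
  shows "drift \<epsilon>' x' \<le> drift \<epsilon> x"
proof -
  have "k / (max x' 0 + \<epsilon>') \<le> k / (max x 0 + \<epsilon>)"
    using assms k_pos by (intro divide_left_mono mult_pos_pos) (auto simp: max_def)
  moreover have "a * x \<le> a * x'" using assms a_pos by simp
  ultimately show ?thesis by (simp add: drift_def)
qed

text \<open>If the solution for the larger \<epsilon>' were above at \<open>t\<close>, consider the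
  last meeting time \<open>u\<close> of the two solutions. From \<open>u\<close> on its drift is the
  smaller one by \<open>drift_mono\<close> and the noise cancels, so it cannot get ahead.\<close>

lemma ye_antimono:
  assumes "0 < \<epsilon>" "\<epsilon> \<le> \<epsilon>'" "0 \<le> t"
  shows "ye \<epsilon>' t \<le> ye \<epsilon> t"
proof (rule ccontr)
  assume neg: "\<not> ye \<epsilon>' t \<le> ye \<epsilon> t"
  have e': "0 < \<epsilon>'" using assms by simp
  have "continuous_on {0..t} (\<lambda>u. ye \<epsilon>' u - ye \<epsilon> u)"
    using assms e' by (intro continuous_intros ye_cont) auto
  then obtain u where u: "0 \<le> u" "u \<le> t" "ye \<epsilon>' u - ye \<epsilon> u = 0"
    "\<And>v. u \<le> v \<Longrightarrow> v \<le> t \<Longrightarrow> 0 \<le> ye \<epsilon>' v - ye \<epsilon> v"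
    by (rule last_crossing[of 0 t _ 0]) (use assms e' neg ye_0 in auto)
  have "integral {u..t} (\<lambda>v. drift \<epsilon>' (ye \<epsilon>' v)) \<le> integral {u..t} (\<lambda>v. drift \<epsilon> (ye \<epsilon> v))"
    using u assms e' by (intro integral_le drift_integrable drift_mono) auto
  with ye_increment[OF e' u(1,2)] ye_increment[OF assms(1) u(1,2)] u(3) neg
  show False by simp
qed

text \<open>After the last crossing of the level \<open>max (ye \<epsilon> r) c\<close> the solution
  is at least \<open>c\<close>, so the drift is at most \<open>k / c\<close>, whatever \<epsilon>
  is.\<close>

lemma ye_upper:
  assumes \<epsilon>: "0 < \<epsilon>" and "0 \<le> r" "r \<le> s" and c: "0 < c"
    and w: "\<And>u. r \<le> u \<Longrightarrow> u \<le> s \<Longrightarrow> \<bar>b s - b u\<bar> \<le> w"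
  shows "ye \<epsilon> s \<le> max (ye \<epsilon> r) c + k / c * (s - r) + \<sigma> * w"
proof -
  define d where "d = max (ye \<epsilon> r) c"
  have d: "ye \<epsilon> r \<le> d" "c \<le> d" "0 < d" using c by (auto simp: d_def)
  have "0 \<le> w" using w[of s] assms by simp
  show ?thesis
  proof (cases "ye \<epsilon> s \<le> d")
    case True
    moreover have "0 \<le> k / c * (s - r)" "0 \<le> \<sigma> * w"
      using k_pos c assms \<sigma>_pos \<open>0 \<le> w\<close> by auto
    ultimately show ?thesis by (simp add: d_def)
  next
    case False
    have cont: "continuous_on {r..s} (ye \<epsilon>)"
      using assms by (intro ye_cont) auto
    obtain u where u: "r \<le> u" "u \<le> s" "ye \<epsilon> u = d" "\<And>v. u \<le> v \<Longrightarrow> v \<le> s \<Longrightarrow> d \<le> ye \<epsilon> v"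
      by (rule last_crossing[OF cont, of d]) (use assms d False in auto)
    have "integral {u..s} (\<lambda>v. drift \<epsilon> (ye \<epsilon> v)) \<le> integral {u..s} (\<lambda>v. k / c)"
      using assms u d by (intro integral_le drift_integrable drift_le) (auto intro: order_trans)
    also have "\<dots> = k / c * (s - u)"
      using u by simp
    also have "\<dots> \<le> k / c * (s - r)"
      using u k_pos c by (intro mult_left_mono) auto
    finally have "integral {u..s} (\<lambda>v. drift \<epsilon> (ye \<epsilon> v)) \<le> k / c * (s - r)" .
    moreover have "\<sigma> * (b s - b u) \<le> \<sigma> * w"
      using w[OF u(1,2)] \<sigma>_pos by (intro mult_left_mono) auto
    ultimately show ?thesis
      using ye_increment[of \<epsilon> u s] u assms by (simp add: d_def)
  qed
qed

lemma b_bounded: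
  obtains W where "0 \<le> W" "\<And>s u. s \<in> {0..T} \<Longrightarrow> u \<in> {0..T} \<Longrightarrow> \<bar>b s - b u\<bar> \<le> W"
proof -
  have "bounded (b ` {0..T})"
    by (intro compact_imp_bounded compact_continuous_image b_cont') auto
  then obtain C where C: "0 < C" "\<And>s. s \<in> {0..T} \<Longrightarrow> \<bar>b s\<bar> \<le> C"
    unfolding bounded_pos by auto
  have "\<bar>b s - b u\<bar> \<le> 2 * C" if "s \<in> {0..T}" "u \<in> {0..T}" for s u
    using C(2)[OF that(1)] C(2)[OF that(2)] by linarith
  with C(1) show thesis by (intro that[of "2 * C"]) auto
qed

lemma ye_bounded:
  obtains K where "0 \<le> K" "\<And>\<epsilon> t. 0 < \<epsilon> \<Longrightarrow> t \<in> {0..T} \<Longrightarrow> ye \<epsilon> t \<le> K"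
proof -
  obtain W where W: "0 \<le> W" "\<And>s u. s \<in> {0..T} \<Longrightarrow> u \<in> {0..T} \<Longrightarrow> \<bar>b s - b u\<bar> \<le> W"
    using b_bounded by blast
  \<comment> \<open>This is \<open>ye_upper\<close> from time 0 with level \<open>Y0\<close>; the
    absolute value keeps the bound nonnegative for negative \<open>T\<close> as well.\<close>
  have "ye \<epsilon> t \<le> Y0 + k / Y0 * \<bar>T\<bar> + \<sigma> * W" if "0 < \<epsilon>" "t \<in> {0..T}" for \<epsilon> t
  proof -
    have "ye \<epsilon> t \<le> max (ye \<epsilon> 0) Y0 + k / Y0 * (t - 0) + \<sigma> * W"
      by (rule ye_upper) (use that Y0_pos W in auto)
    moreover have "k / Y0 * t \<le> k / Y0 * \<bar>T\<bar>"
      using that Y0_pos k_pos by (intro mult_left_mono) auto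
    ultimately show ?thesis using that ye_0 by simp
  qed
  moreover have "0 \<le> Y0 + k / Y0 * \<bar>T\<bar> + \<sigma> * W"
    using Y0_pos k_pos \<sigma>_pos W(1) by (intro add_nonneg_nonneg mult_nonneg_nonneg) auto
  ultimately show thesis by (rule that[rotated])
qed

section \<open>The monotone limit: existence, sign and continuity\<close>

text \<open>As \<epsilon> decreases, the values increase and stay bounded, so they converge to their
  supremum. This makes the \<open>Lim\<close> in \<open>y\<close> a genuine limit.\<close>

lemma ye_tendsto:
  assumes "0 \<le> t"
  shows "((\<lambda>\<epsilon>. ye \<epsilon> t) \<longlongrightarrow> y t) (at_right 0)"
proof -
  obtain K where K: "\<And>\<epsilon>. 0 < \<epsilon> \<Longrightarrow> ye \<epsilon> t \<le> K"
    using ye_bounded[of t] assms by (metis atLeastAtMost_iff order_refl)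
  have bdd: "bdd_above ((\<lambda>\<epsilon>. ye \<epsilon> t) ` {0<..})"
    using K by (intro bdd_aboveI2[of _ _ K]) auto
  have "((\<lambda>\<epsilon>. ye \<epsilon> t) \<longlongrightarrow> (SUP \<epsilon>\<in>{0<..}. ye \<epsilon> t)) (at_right 0)"
  proof (rule increasing_tendsto)
    show "\<forall>\<^sub>F \<epsilon> in at_right 0. ye \<epsilon> t \<le> (SUP \<epsilon>\<in>{0<..}. ye \<epsilon> t)"
      using bdd by (auto simp: eventually_at_right_field intro!: exI[of _ 1] cSUP_upper)
  next
    fix x assume "x < (SUP \<epsilon>\<in>{0<..}. ye \<epsilon> t)"
    then obtain \<epsilon>' where \<epsilon>': "0 < \<epsilon>'" "x < ye \<epsilon>' t"
      using less_cSUP_iff[OF _ bdd] by auto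
    have "x < ye \<epsilon> t" if "0 < \<epsilon>" "\<epsilon> < \<epsilon>'" for \<epsilon>
      using ye_antimono[of \<epsilon> \<epsilon>' t] that \<epsilon>' assms by simp
    then show "\<forall>\<^sub>F \<epsilon> in at_right 0. x < ye \<epsilon> t"
      using \<epsilon>'(1) by (auto simp: eventually_at_right_field)
  qed
  then show ?thesis
    unfolding y_def using tendsto_Lim[OF trivial_limit_at_right_real] by metis
qed

text \<open>A sequential version, for Fatou's lemma and dominated convergence.\<close>

lemma ye_seq_tendsto:
  assumes "0 \<le> t"
  shows "(\<lambda>n. ye (inverse (real (Suc n))) t) \<longlonglongrightarrow> y t"
proof (rule filterlim_compose[OF ye_tendsto[OF assms]])
  show "filterlim (\<lambda>n. inverse (real (Suc n))) (at_right 0) sequentially"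
    unfolding filterlim_at using LIMSEQ_inverse_real_of_nat by auto
qed

lemma y_le:
  assumes "0 \<le> t" "\<And>\<epsilon>. 0 < \<epsilon> \<Longrightarrow> ye \<epsilon> t \<le> C"
  shows "y t \<le> C"
  by (rule tendsto_upperbound[OF ye_tendsto[OF assms(1)]])
     (use assms in \<open>auto simp: eventually_at_right_field intro!: exI[of _ 1]\<close>)

lemma ye_le_y:
  assumes "0 < \<epsilon>" "0 \<le> t"
  shows "ye \<epsilon> t \<le> y t"
  by (rule tendsto_lowerbound[OF ye_tendsto[OF assms(2)]])
     (use assms in \<open>auto simp: eventually_at_right_field intro!: exI[of _ \<epsilon>] ye_antimono\<close>)

lemma y_0: "y 0 = Y0"
proof (rule antisym)
  show "y 0 \<le> Y0" by (rule y_le) (auto simp: ye_0)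
  show "Y0 \<le> y 0" using ye_le_y[of 1 0] by (simp add: ye_0)
qed

text \<open>If \<open>y t = -\<delta> < 0\<close>, then after the last passage of
  \<open>ye \<epsilon>\<close> through \<open>-\<delta> / 2\<close> the drift is at least
  \<open>k / \<epsilon>\<close>, so the noise alone must produce the fall. Over a short time
  continuity of \<open>b\<close> forbids this; over a longer time the upward drift outweighs any
  possible fall of the noise.\<close>

lemma y_nonneg:
  assumes t: "0 \<le> t"
  shows "0 \<le> y t"
proof (rule ccontr)
  assume "\<not> 0 \<le> y t"
  define \<delta> where "\<delta> = - y t"
  have \<delta>: "0 < \<delta>" using \<open>\<not> 0 \<le> y t\<close> by (simp add: \<delta>_def)
  have "0 < \<delta> / (2 * \<sigma>)" using \<delta> \<sigma>_pos by simp
  then obtain \<eta> where \<eta>: "0 < \<eta>" "\<And>u. 0 \<le> u \<Longrightarrow> \<bar>u - t\<bar> < \<eta> \<Longrightarrow> \<bar>b u - b t\<bar> < \<delta> / (2 * \<sigma>)"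
    using b_cont t unfolding continuous_on_iff dist_real_def by (metis atLeast_iff)
  obtain W where W: "0 \<le> W" "\<And>s u. s \<in> {0..t} \<Longrightarrow> u \<in> {0..t} \<Longrightarrow> \<bar>b s - b u\<bar> \<le> W"
    using b_bounded by blast
  \<comment> \<open>Chosen so that \<open>k / \<epsilon> * \<eta> = \<sigma> * W + 1\<close>: over a
    time \<eta> the drift then lifts by more than the noise can lower.\<close>
  define \<epsilon> where "\<epsilon> = k * \<eta> / (\<sigma> * W + 1)"
  have W': "0 < \<sigma> * W + 1" using W(1) \<sigma>_pos by (simp add: add_nonneg_pos)
  have \<epsilon>: "0 < \<epsilon>" unfolding \<epsilon>_def using W' \<eta>(1) k_pos by simp
  \<comment> \<open>The sign is reversed because \<open>last_crossing\<close> handles upward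
    passages.\<close>
  have cont: "continuous_on {0..t} (\<lambda>u. - ye \<epsilon> u)"
    using \<epsilon> by (intro continuous_intros ye_cont) auto
  obtain u where u: "0 \<le> u" "u \<le> t" "- ye \<epsilon> u = \<delta> / 2"
    "\<And>v. u \<le> v \<Longrightarrow> v \<le> t \<Longrightarrow> \<delta> / 2 \<le> - ye \<epsilon> v"
    by (rule last_crossing[OF cont, of "\<delta> / 2"])
       (use t \<delta> Y0_pos ye_0[OF \<epsilon>] ye_le_y[OF \<epsilon> t] in \<open>auto simp: \<delta>_def\<close>)
  have "k / \<epsilon> \<le> drift \<epsilon> (ye \<epsilon> v)" if "u \<le> v" "v \<le> t" for v
    using u(4)[OF that] \<delta> a_pos mult_nonneg_nonpos[of a "ye \<epsilon> v"]
    by (auto simp: drift_def max_def)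
  then have "integral {u..t} (\<lambda>v. k / \<epsilon>) \<le> integral {u..t} (\<lambda>v. drift \<epsilon> (ye \<epsilon> v))"
    using u \<epsilon> by (intro integral_le drift_integrable) auto
  then have "k / \<epsilon> * (t - u) \<le> integral {u..t} (\<lambda>v. drift \<epsilon> (ye \<epsilon> v))"
    using u by (simp add: mult.commute)
  then have drop: "k / \<epsilon> * (t - u) \<le> - \<delta> / 2 - \<sigma> * (b t - b u)"
    using ye_increment[OF \<epsilon> u(1,2)] u(2,3) ye_le_y[OF \<epsilon> t] \<delta>_def by linarith
  show False
  proof (cases "t - u < \<eta>")
    case True
    then have "b u - b t < \<delta> / (2 * \<sigma>)" using \<eta>(2)[of u] u by auto
    then have "\<sigma> * (b u - b t) < \<delta> / 2" using \<sigma>_pos by (simp add: field_simps)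
    moreover have "0 \<le> k / \<epsilon> * (t - u)" using k_pos \<epsilon> u by simp
    ultimately show False using drop by (simp add: algebra_simps)
  next
    case False
    have "\<sigma> * W + 1 = k / \<epsilon> * \<eta>"
      using k_pos \<eta>(1) W' by (simp add: \<epsilon>_def)
    also have "\<dots> \<le> k / \<epsilon> * (t - u)"
      using False k_pos \<epsilon> by (intro mult_left_mono) auto
    also have "\<dots> < \<sigma> * (b u - b t)" using drop \<delta> by (simp add: algebra_simps)
    also have "\<dots> \<le> \<sigma> * W"
      using W(2)[of u t] u t \<sigma>_pos by (intro mult_left_mono) auto
    finally show False by simp
  qed
qed

text \<open>Upward moves are limited by \<open>ye_upper\<close>, downward ones by the drift being at
  least \<open>-(a * K)\<close>. The extra \<open>c\<close> is the cost of keeping the singular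
  drift below \<open>k / c\<close> even when \<open>y r\<close> is near zero.\<close>

lemma y_modulus:
  assumes K: "0 \<le> K" "\<And>\<epsilon> t. 0 < \<epsilon> \<Longrightarrow> t \<in> {0..T} \<Longrightarrow> ye \<epsilon> t \<le> K"
    and rs: "0 \<le> r" "r \<le> s" "s \<le> T" and c: "0 < c"
    and w: "\<And>u. r \<le> u \<Longrightarrow> u \<le> s \<Longrightarrow> \<bar>b s - b u\<bar> \<le> w"
  shows "\<bar>y s - y r\<bar> \<le> c + (k / c + a * K) * (s - r) + \<sigma> * w"
proof -
  have s: "0 \<le> s" using rs by simp
  have "y s \<le> y r + c + k / c * (s - r) + \<sigma> * w"
  proof (rule y_le[OF s])
    fix \<epsilon> :: real assume \<epsilon>: "0 < \<epsilon>"
    have "max (ye \<epsilon> r) c \<le> y r + c"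
      using ye_le_y[OF \<epsilon> rs(1)] y_nonneg[OF rs(1)] c by auto
    with ye_upper[OF \<epsilon> rs(1,2) c w] show "ye \<epsilon> s \<le> y r + c + k / c * (s - r) + \<sigma> * w"
      by linarith
  qed
  moreover have "y r \<le> y s + a * K * (s - r) + \<sigma> * w"
  proof (rule y_le[OF rs(1)])
    fix \<epsilon> :: real assume \<epsilon>: "0 < \<epsilon>"
    have "- (a * K) \<le> drift \<epsilon> (ye \<epsilon> v)" if "r \<le> v" "v \<le> s" for v
    proof -
      have "a * ye \<epsilon> v \<le> a * K" using K(2)[OF \<epsilon>, of v] that rs a_pos by (intro mult_left_mono) auto
      moreover have "0 \<le> k / (max (ye \<epsilon> v) 0 + \<epsilon>)" using k_pos \<epsilon> by (simp add: max_def)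
      ultimately show ?thesis by (simp add: drift_def)
    qed
    then have "integral {r..s} (\<lambda>v. - (a * K)) \<le> integral {r..s} (\<lambda>v. drift \<epsilon> (ye \<epsilon> v))"
      using rs \<epsilon> by (intro integral_le drift_integrable) auto
    then have "- (a * K * (s - r)) \<le> integral {r..s} (\<lambda>v. drift \<epsilon> (ye \<epsilon> v))"
      using rs by (simp add: algebra_simps)
    moreover have "\<sigma> * (b r - b s) \<le> \<sigma> * w"
      using w[of r] rs \<sigma>_pos by (intro mult_left_mono) auto
    ultimately show "ye \<epsilon> r \<le> y s + a * K * (s - r) + \<sigma> * w"
      using ye_increment[OF \<epsilon> rs(1,2)] ye_le_y[OF \<epsilon> s] by (simp add: algebra_simps)
  qed
  moreover have "0 \<le> a * K * (s - r)" "0 \<le> k / c * (s - r)"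
    using a_pos K(1) rs k_pos c by auto
  ultimately show ?thesis using c by (simp add: abs_le_iff algebra_simps)
qed

lemma y_cont_interval: "continuous_on {0..T} y"
proof -
  obtain K where K: "0 \<le> K" "\<And>\<epsilon> t. 0 < \<epsilon> \<Longrightarrow> t \<in> {0..T} \<Longrightarrow> ye \<epsilon> t \<le> K"
    using ye_bounded by blast
  have unif: "uniformly_continuous_on {0..T} b"
    by (intro compact_uniformly_continuous b_cont') auto
  have "uniformly_continuous_on {0..T} y"
    unfolding uniformly_continuous_on_def
  proof (intro allI impI)
    fix e :: real assume e: "0 < e"
    \<comment> \<open>The level, time and noise errors are each at most \<open>e / 4\<close>. The
      level comes first, since the admissible time step depends on \<open>k / c\<close>.\<close>
    define c where "c = e / 4"
    define L where "L = k / c + a * K + 1"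
    have c: "0 < c" using e by (simp add: c_def)
    have L: "0 < L" "k / c + a * K \<le> L"
      using c k_pos a_pos K(1) by (auto simp: L_def add_nonneg_pos)
    have "0 < e / (4 * \<sigma>)" using e \<sigma>_pos by simp
    then obtain d where d: "0 < d"
      "\<And>u v. u \<in> {0..T} \<Longrightarrow> v \<in> {0..T} \<Longrightarrow> \<bar>u - v\<bar> < d \<Longrightarrow> \<bar>b u - b v\<bar> < e / (4 * \<sigma>)"
      using unif unfolding uniformly_continuous_on_def dist_real_def by metis
    have ord: "\<bar>y s - y r\<bar> < e" if rs: "0 \<le> r" "r \<le> s" "s \<le> T" "s - r < min d (e / (4 * L))" for r s
    proof -
      have "\<bar>b s - b u\<bar> \<le> e / (4 * \<sigma>)" if "r \<le> u" "u \<le> s" for u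
        using d(2)[of s u] that rs by auto
      with rs have "\<bar>y s - y r\<bar> \<le> c + (k / c + a * K) * (s - r) + \<sigma> * (e / (4 * \<sigma>))"
        by (intro y_modulus[OF K _ _ _ c]) auto
      also have "(k / c + a * K) * (s - r) \<le> L * (e / (4 * L))"
        using rs L c k_pos a_pos K(1) by (intro mult_mono) auto
      finally show ?thesis
        using e \<sigma>_pos L by (simp add: c_def)
    qed
    show "\<exists>d>0. \<forall>x\<in>{0..T}. \<forall>x'\<in>{0..T}. dist x' x < d \<longrightarrow> dist (y x') (y x) < e"
    proof (intro exI[of _ "min d (e / (4 * L))"] conjI ballI impI)
      show "0 < min d (e / (4 * L))" using d e L by simp
      fix x x' assume "x \<in> {0..T}" "x' \<in> {0..T}" "dist x' x < min d (e / (4 * L))"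
      then show "dist (y x') (y x) < e"
        using ord[of x x'] ord[of x' x] by (cases "x \<le> x'") (auto simp: dist_real_def)
    qed
  qed
  then show ?thesis by (rule uniformly_continuous_imp_continuous)
qed

lemma y_cont: "continuous_on {0..} y"
  unfolding continuous_on_eq_continuous_within
proof
  fix x :: real assume "x \<in> {0..}"
  then have "continuous (at x within {0..x + 1}) y"
    using y_cont_interval[of "x + 1"] by (auto simp: continuous_on_eq_continuous_within)
  also have "at x within {0..x + 1} = at x within {0..}"
    by (rule at_within_nhd[of _ "{..<x + 1}"]) auto
  finally show "continuous (at x within {0..}) y" .
qed

section \<open>Integrability of the limiting drift\<close>

text \<open>At a zero of \<open>y\<close> division by zero gives the value 0;
  \<open>AE_y_pos\<close> shows that such points form a null set.\<close>

definition limit_drift :: "real \<Rightarrow> real" where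
  "limit_drift s = k / y s - a * y s"

text \<open>Both claims come from Fatou's lemma for the regularised singular terms along \<epsilon>
  = 1/(n+1). Their integrals are bounded through the equation, and their lower limit is
  \<open>k / y\<close> where \<open>y > 0\<close> and infinite where \<open>y = 0\<close>.\<close>

lemma
  assumes T: "0 \<le> T"
  shows singular_set_integrable: "set_integrable lborel {0..T} (\<lambda>s. k / y s)"
    and AE_y_pos: "AE s in lborel. s \<in> {0..T} \<longrightarrow> 0 < y s"
proof -
  define e where "e n = inverse (real (Suc n))" for n
  have e: "0 < e n" for n by (simp add: e_def)
  define G where "G n u = indicator {0..T} u *\<^sub>R (k / (max (ye (e n) u) 0 + e n))" for n u
  obtain K where K: "0 \<le> K" "\<And>\<epsilon> t. 0 < \<epsilon> \<Longrightarrow> t \<in> {0..T} \<Longrightarrow> ye \<epsilon> t \<le> K"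
    using ye_bounded by blast
  \<comment> \<open>The equation at time \<open>T\<close>, solved for the integral of the singular
    term, with every \<open>ye\<close> bounded by \<open>K\<close>.\<close>
  define C where "C = K - Y0 - \<sigma> * b T + a * (K * T)"
  have G_int: "set_integrable lborel {0..T} (\<lambda>u. k / (max (ye (e n) u) 0 + e n))" for n
    by (rule borel_integrable_atLeastAtMost') (use e T in \<open>auto intro: singular_cont\<close>)
  have [measurable]: "G n \<in> borel_measurable borel" for n
    using borel_measurable_integrable[OF G_int[of n, unfolded set_integrable_def]]
    by (simp add: G_def[abs_def])
  have G_le: "(\<integral>\<^sup>+u. ennreal (G n u) \<partial>lborel) \<le> ennreal C" for n
  proof -
    have ye_int: "ye (e n) integrable_on {0..T}"
      by (rule integrable_continuous_interval) (use e in \<open>auto intro: ye_cont\<close>)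
    have "(\<integral>\<^sup>+u. ennreal (G n u) \<partial>lborel) = ennreal (LINT u:{0..T}|lborel. k / (max (ye (e n) u) 0 + e n))"
      using G_int[of n] k_pos e[of n] unfolding G_def set_integrable_def set_lebesgue_integral_def
      by (intro nn_integral_eq_integral) (auto simp: max_def)
    also have "(LINT u:{0..T}|lborel. k / (max (ye (e n) u) 0 + e n)) =
        integral {0..T} (\<lambda>u. drift (e n) (ye (e n) u) + a * ye (e n) u)"
      by (simp add: set_borel_integral_eq_integral(2)[OF G_int] drift_def)
    also have "\<dots> = integral {0..T} (\<lambda>u. drift (e n) (ye (e n) u)) + a * integral {0..T} (ye (e n))"
      by (subst Henstock_Kurzweil_Integration.integral_add)
         (use e ye_int in \<open>auto intro: drift_integrable integrable_on_mult_right\<close>)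
    also have "\<dots> \<le> C"
    proof -
      have "integral {0..T} (ye (e n)) \<le> integral {0..T} (\<lambda>u. K)"
        by (intro integral_le ye_int) (use K e in auto)
      then have "integral {0..T} (ye (e n)) \<le> K * T"
        using T by (simp add: mult.commute)
      then have "a * integral {0..T} (ye (e n)) \<le> a * (K * T)"
        using a_pos by (intro mult_left_mono) auto
      moreover have "ye (e n) T \<le> K" using K(2)[OF e] T by auto
      ultimately show ?thesis
        using ye_eq_0[OF e T, of n] unfolding C_def by linarith
    qed
    finally show ?thesis by (simp add: ennreal_leI)
  qed
  define F where "F u = liminf (\<lambda>n. ennreal (G n u))" for u
  have [measurable]: "F \<in> borel_measurable borel"
    unfolding F_def[abs_def] by measurable
  have "(\<integral>\<^sup>+u. F u \<partial>lborel) \<le> liminf (\<lambda>n. \<integral>\<^sup>+u. ennreal (G n u) \<partial>lborel)"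
    unfolding F_def by (intro nn_integral_liminf) auto
  also have "\<dots> \<le> liminf (\<lambda>n. ennreal C)"
    by (intro Liminf_mono always_eventually allI G_le)
  also have "\<dots> < \<infinity>"
    by (simp add: Liminf_const)
  finally have F_fin: "(\<integral>\<^sup>+u. F u \<partial>lborel) < \<infinity>" .
  have F_pos: "F u = ennreal (k / y u)" if u: "u \<in> {0..T}" "0 < y u" for u
  proof -
    have "(\<lambda>n. k / (max (ye (e n) u) 0 + e n)) \<longlonglongrightarrow> k / (max (y u) 0 + 0)"
      unfolding e_def using u
      by (intro tendsto_intros ye_seq_tendsto LIMSEQ_inverse_real_of_nat) auto
    then have "(\<lambda>n. ennreal (G n u)) \<longlonglongrightarrow> ennreal (k / y u)"
      using u by (intro tendsto_ennrealI) (simp add: G_def)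
    then show ?thesis
      unfolding F_def by (intro lim_imp_Liminf) auto
  qed
  have F_zero: "F u = \<infinity>" if u: "u \<in> {0..T}" "y u = 0" for u
  proof -
    have "ye (e n) u \<le> 0" for n
      using ye_le_y[OF e, of u n] u by auto
    \<comment> \<open>At a zero of \<open>y\<close> the approximations are nonpositive, so only
      \<epsilon> is left in the denominator.\<close>
    then have "G n u = k * real (Suc n)" for n
      using u by (simp add: G_def max_def e_def field_simps)
    moreover have "filterlim (\<lambda>n. k * real (Suc n)) at_top sequentially"
      using k_pos
      by (intro filterlim_tendsto_pos_mult_at_top[OF tendsto_const]
          filterlim_compose[OF filterlim_real_sequentially filterlim_Suc]) auto
    ultimately have "(\<lambda>n. ennreal (G n u)) \<longlonglongrightarrow> \<infinity>"
      by (simp add: ennreal_tendsto_top_eq_at_top)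
    then show ?thesis
      unfolding F_def by (intro lim_imp_Liminf) auto
  qed
  have "AE u in lborel. F u \<noteq> \<infinity>"
    using F_fin by (intro nn_integral_PInf_AE) auto
  then show "AE s in lborel. s \<in> {0..T} \<longrightarrow> 0 < y s"
  proof (rule AE_mp, intro AE_I2 impI)
    fix s assume "F s \<noteq> \<infinity>" "s \<in> {0..T}"
    then show "0 < y s" using F_zero[of s] y_nonneg[of s] by fastforce
  qed
  have "(\<lambda>u. indicator {0..T} u *\<^sub>R y u) \<in> borel_measurable borel"
    by (intro borel_measurable_continuous_on_indicator y_cont_interval) auto
  \<comment> \<open>The inner indicator makes the denominator Borel on the whole line; under the
    outer one it changes nothing.\<close>
  then have "(\<lambda>u. indicator {0..T} u *\<^sub>R (k / (indicator {0..T} u *\<^sub>R y u))) \<in> borel_measurable borel"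
    by measurable
  also have "(\<lambda>u. indicator {0..T} u *\<^sub>R (k / (indicator {0..T} u *\<^sub>R y u))) =
      (\<lambda>u. indicator {0..T} u *\<^sub>R (k / y u))"
    by (auto simp: indicator_def)
  finally have meas: "(\<lambda>u. indicator {0..T} u *\<^sub>R (k / y u)) \<in> borel_measurable lborel"
    by simp
  have "ennreal (indicator {0..T} u *\<^sub>R (k / y u)) \<le> F u" for u
    using F_pos[of u] y_nonneg[of u] by (cases "u \<in> {0..T} \<and> 0 < y u") (auto simp: indicator_def less_le)
  then have "(\<integral>\<^sup>+u. ennreal (indicator {0..T} u *\<^sub>R (k / y u)) \<partial>lborel) \<le> (\<integral>\<^sup>+u. F u \<partial>lborel)"
    by (rule nn_integral_mono)
  also note F_fin
  finally show "set_integrable lborel {0..T} (\<lambda>s. k / y s)"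
    unfolding set_integrable_def using k_pos y_nonneg
    by (intro integrableI_nonneg meas) (auto simp: indicator_def)
qed

lemma limit_drift_integrable:
  assumes "0 \<le> T"
  shows "set_integrable lborel {0..T} limit_drift"
  unfolding limit_drift_def[abs_def]
  by (intro set_integral_diff(1) singular_set_integrable assms borel_integrable_atLeastAtMost'
      continuous_intros y_cont_interval)

lemma limit_drift_integrable_on: "0 \<le> r \<Longrightarrow> limit_drift integrable_on {r..s}"
  by (rule integrable_on_subinterval[OF set_borel_integral_eq_integral(1)[OF limit_drift_integrable[of "max s 0"]]])
     auto

section \<open>The limit equation on excursions\<close>

text \<open>A Dini argument with \<open>c\<close> half the minimum of \<open>y\<close>. Otherwise
  points with \<open>ye (e n) (x n) < c\<close> accumulate at some \<open>l\<close>; monotonicity in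
  \<epsilon> gives \<open>ye (e N) l \<le> c\<close> for each fixed \<open>N\<close>, hence
  \<open>y l \<le> c\<close>.\<close>

lemma ye_uniformly_pos:
  assumes "0 \<le> r" "r \<le> s" "\<And>u. u \<in> {r..s} \<Longrightarrow> 0 < y u"
  obtains c \<epsilon> where "0 < c" "0 < \<epsilon>" "\<And>\<epsilon>' u. 0 < \<epsilon>' \<Longrightarrow> \<epsilon>' \<le> \<epsilon> \<Longrightarrow> u \<in> {r..s} \<Longrightarrow> c \<le> ye \<epsilon>' u"
proof -
  define e where "e n = inverse (real (Suc n))" for n
  have e: "0 < e n" for n by (simp add: e_def)
  have "continuous_on {r..s} y"
    by (rule continuous_on_subset[OF y_cont]) (use assms in auto)
  then obtain x0 where x0: "x0 \<in> {r..s}" "\<And>u. u \<in> {r..s} \<Longrightarrow> y x0 \<le> y u"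
    using continuous_attains_inf[of "{r..s}" y] assms by auto
  define c where "c = y x0 / 2"
  have c: "0 < c" "\<And>u. u \<in> {r..s} \<Longrightarrow> c < y u"
    using x0 assms(3)[of x0] by (force simp: c_def)+
  have "\<exists>n. \<forall>u\<in>{r..s}. c \<le> ye (e n) u"
  proof (rule ccontr)
    assume "\<not> ?thesis"
    then have "\<forall>n. \<exists>u\<in>{r..s}. ye (e n) u < c" by (auto simp: not_le)
    then obtain x where x: "\<And>n. x n \<in> {r..s}" "\<And>n. ye (e n) (x n) < c" by metis
    obtain l \<phi> where l: "l \<in> {r..s}" "strict_mono \<phi>" "(x \<circ> \<phi>) \<longlonglongrightarrow> l"
      using compact_Icc[of r s] x(1) unfolding compact_def by metis
    have "ye (e N) l \<le> c" for N
    proof (rule tendsto_upperbound)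
      have "continuous_on {r..s} (ye (e N))"
        using assms e by (intro ye_cont) auto
      then show "((\<lambda>n. ye (e N) ((x \<circ> \<phi>) n)) \<longlongrightarrow> ye (e N) l) sequentially"
        by (rule continuous_on_tendsto_compose) (use l x in \<open>auto simp: comp_def\<close>)
      have "ye (e N) ((x \<circ> \<phi>) n) \<le> c" if "N \<le> n" for n
      proof -
        have "N \<le> \<phi> n" using that seq_suble[OF l(2)] le_trans by blast
        then have "ye (e N) (x (\<phi> n)) \<le> ye (e (\<phi> n)) (x (\<phi> n))"
          using x(1)[of "\<phi> n"] assms by (intro ye_antimono e) (auto simp: e_def field_simps)
        with x(2)[of "\<phi> n"] show ?thesis by simp
      qed
      then show "\<forall>\<^sub>F n in sequentially. ye (e N) ((x \<circ> \<phi>) n) \<le> c"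
        by (rule eventually_sequentiallyI)
    qed simp
    then have "y l \<le> c"
      using l(1) assms unfolding e_def
      by (intro tendsto_upperbound[OF ye_seq_tendsto]) (auto intro: always_eventually)
    with c(2)[OF l(1)] show False by simp
  qed
  then obtain n where n: "\<And>u. u \<in> {r..s} \<Longrightarrow> c \<le> ye (e n) u" by blast
  show thesis
  proof (rule that[OF c(1) e[of n]])
    fix \<epsilon>' u assume "0 < \<epsilon>'" "\<epsilon>' \<le> e n" "u \<in> {r..s}"
    then show "c \<le> ye \<epsilon>' u"
      using n[of u] ye_antimono[of \<epsilon>' "e n" u] assms by auto
  qed
qed

text \<open>Dominated convergence in \<open>ye_increment\<close>: the lower bound \<open>c\<close>
  on the approximations bounds their drifts by \<open>k / c + a * K\<close>.\<close>

lemma y_increment_pos: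
  assumes rs: "0 \<le> r" "r \<le> s" and pos: "\<And>u. u \<in> {r..s} \<Longrightarrow> 0 < y u"
  shows "y s = y r + integral {r..s} limit_drift + \<sigma> * (b s - b r)"
proof -
  obtain c \<epsilon> where c: "0 < c" "0 < \<epsilon>" "\<And>\<epsilon>' u. 0 < \<epsilon>' \<Longrightarrow> \<epsilon>' \<le> \<epsilon> \<Longrightarrow> u \<in> {r..s} \<Longrightarrow> c \<le> ye \<epsilon>' u"
    using ye_uniformly_pos[OF rs pos] by blast
  obtain N where N: "inverse (real (Suc N)) < \<epsilon>"
    using reals_Archimedean c(2) by blast
  \<comment> \<open>The shift by \<open>N\<close> keeps all terms below the threshold \<epsilon>
    from which the lower bound \<open>c\<close> holds.\<close>
  define e where "e n = inverse (real (Suc (n + N)))" for n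
  have e: "0 < e n" for n by (simp add: e_def)
  have e_le: "e n \<le> \<epsilon>" for n
  proof -
    have "e n \<le> inverse (real (Suc N))" by (simp add: e_def field_simps)
    with N show ?thesis by simp
  qed
  have lim: "(\<lambda>n. ye (e n) u) \<longlonglongrightarrow> y u" if "0 \<le> u" for u
    unfolding e_def using LIMSEQ_ignore_initial_segment[OF ye_seq_tendsto[OF that], of N] .
  have e_lim: "e \<longlonglongrightarrow> 0"
    unfolding e_def[abs_def] using LIMSEQ_ignore_initial_segment[OF LIMSEQ_inverse_real_of_nat, of N] .
  obtain K where K: "0 \<le> K" "\<And>\<epsilon> t. 0 < \<epsilon> \<Longrightarrow> t \<in> {0..s} \<Longrightarrow> ye \<epsilon> t \<le> K"
    using ye_bounded by blast
  have "(\<lambda>n. integral {r..s} (\<lambda>u. drift (e n) (ye (e n) u))) \<longlonglongrightarrow> integral {r..s} limit_drift"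
  proof (rule dominated_convergence)
    show "(\<lambda>u. drift (e n) (ye (e n) u)) integrable_on {r..s}" for n
      using drift_integrable[OF e] rs by blast
    show "(\<lambda>u. k / c + a * K) integrable_on {r..s}" by (rule integrable_const_ivl)
    show "norm (drift (e n) (ye (e n) u)) \<le> k / c + a * K" if u: "u \<in> {r..s}" for n u
    proof -
      have "c \<le> ye (e n) u" by (rule c(3)[OF e e_le u])
      then have "drift (e n) (ye (e n) u) \<le> k / c" by (rule drift_le[OF e c(1)])
      moreover have "a * ye (e n) u \<le> a * K"
        using K(2)[OF e] u rs a_pos by (intro mult_left_mono) auto
      moreover have "0 \<le> k / (max (ye (e n) u) 0 + e n)"
        using k_pos e[of n] by (simp add: max_def)
      moreover have "0 \<le> k / c" "0 \<le> a * K" using k_pos c a_pos K by auto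
      ultimately show ?thesis by (auto simp: drift_def abs_le_iff)
    qed
    show "(\<lambda>n. drift (e n) (ye (e n) u)) \<longlonglongrightarrow> limit_drift u" if u: "u \<in> {r..s}" for u
    proof -
      have "(\<lambda>n. drift (e n) (ye (e n) u)) \<longlonglongrightarrow> k / (max (y u) 0 + 0) - a * y u"
        unfolding drift_def using u rs pos[OF u]
        by (intro tendsto_intros lim e_lim) auto
      with pos[OF u] show ?thesis by (simp add: limit_drift_def)
    qed
  qed
  then have "(\<lambda>n. ye (e n) r + integral {r..s} (\<lambda>u. drift (e n) (ye (e n) u)) + \<sigma> * (b s - b r))
      \<longlonglongrightarrow> y r + integral {r..s} limit_drift + \<sigma> * (b s - b r)"
    using rs by (intro tendsto_intros lim)
  moreover have "(\<lambda>n. ye (e n) s) \<longlonglongrightarrow> y s"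
    using rs by (intro lim) auto
  ultimately show ?thesis
    using ye_increment[OF e rs] LIMSEQ_unique by simp
qed

text \<open>Here \<open>y\<close> may vanish at the ends. \<open>F\<close>, which is
  \<open>y\<close> with drift and noise removed, is constant inside by
  \<open>y_increment_pos\<close> and continuous up to the ends because the drift is integrable
  there.\<close>

lemma y_increment:
  assumes rs: "0 \<le> r" "r \<le> s" and pos: "\<And>u. r < u \<Longrightarrow> u < s \<Longrightarrow> 0 < y u"
  shows "y s = y r + integral {r..s} limit_drift + \<sigma> * (b s - b r)"
proof (cases "r = s")
  case False
  with rs have "r < s" by simp
  then obtain m where m: "r < m" "m < s" using dense by blast
  define F where "F x = y x - integral {r..x} limit_drift - \<sigma> * b x" for x
  have F_eq: "F q = F p" if "r < p" "p \<le> q" "q < s" for p q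
    using y_increment_pos[of p q] pos that rs
      Henstock_Kurzweil_Integration.integral_combine[of r p q limit_drift] limit_drift_integrable_on[OF rs(1)]
    by (simp add: F_def algebra_simps)
  have F_const: "F x = F m" if "x \<in> {r<..<s}" for x
    using F_eq[of x m] F_eq[of m x] that m by (cases "x \<le> m") auto
  have "continuous_on {r..s} F"
    unfolding F_def[abs_def]
    by (intro continuous_intros indefinite_integral_continuous_1 limit_drift_integrable_on rs b_cont'
        continuous_on_subset[OF y_cont]) (use rs in auto)
  then have "continuous_on (closure {r<..<s}) F"
    using \<open>r < s\<close> by simp
  then have "F x = F m" if "x \<in> {r..s}" for x
    by (rule continuous_constant_on_closure[OF _ F_const]) (use that \<open>r < s\<close> in auto)
  from this[of r] this[of s] rs show ?thesis
    by (simp add: F_def algebra_simps)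
qed auto

section \<open>Splitting the drift integral over the positivity set\<close>

text \<open>Endpoints are null, so one formula serves the half-open initial piece, the open
  excursions and the closed final piece.\<close>

lemma LINT_limit_drift:
  assumes rs: "0 \<le> r" "r \<le> s" and pos: "\<And>u. r < u \<Longrightarrow> u < s \<Longrightarrow> 0 < y u"
    and A: "{r<..<s} \<subseteq> A" "A \<subseteq> {r..s}" "A \<in> sets borel"
  shows "(LBINT u:A. limit_drift u) = y s - y r - \<sigma> * (b s - b r)"
proof -
  have int: "set_integrable lborel {0..s} limit_drift"
    using rs by (intro limit_drift_integrable) simp
  have intA: "set_integrable lborel A limit_drift" and intI: "set_integrable lborel {r..s} limit_drift"
    by (rule set_integrable_subset[OF int]; use A rs in force)+
  have "AE u in lborel. u \<in> {r..s} \<longleftrightarrow> u \<in> A"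
    using AE_lborel_singleton[of r] AE_lborel_singleton[of s]
    by eventually_elim (use A in force)
  then have "(LBINT u:A. limit_drift u) = (LBINT u:{r..s}. limit_drift u)"
    using intA intI
    by (intro set_integral_cong_set)
       (auto simp: set_borel_measurable_def set_integrable_def borel_measurable_integrable)
  also have "\<dots> = integral {r..s} limit_drift"
    by (rule set_borel_integral_eq_integral(2)[OF intI])
  finally show ?thesis
    using y_increment[OF rs pos] by simp
qed

text \<open>The given zero makes the zero set nonempty; being closed and bounded below, it contains
  its infimum.\<close>

lemma first_zero:
  assumes "0 \<le> z" "y z = 0"
  shows "0 < first_zero y" "first_zero y \<le> z" "y (first_zero y) = 0"
    "\<And>u. 0 \<le> u \<Longrightarrow> u < first_zero y \<Longrightarrow> 0 < y u"
proof -
  define Z where "Z = {u \<in> {0..}. y u = 0}"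
  have fz: "first_zero y = Inf Z"
    by (simp add: first_zero_def Z_def)
  have "closed Z"
    unfolding Z_def by (rule continuous_closed_preimage_constant) (auto intro: y_cont)
  moreover have bdd: "bdd_below Z" by (auto simp: Z_def)
  moreover have "z \<in> Z" using assms by (simp add: Z_def)
  ultimately have mem: "first_zero y \<in> Z"
    unfolding fz by (intro closed_contains_Inf) auto
  then show zero: "y (first_zero y) = 0" by (simp add: Z_def)
  show "first_zero y \<le> z"
    unfolding fz using \<open>z \<in> Z\<close> bdd by (rule cInf_lower)
  show "0 < first_zero y"
    using mem zero y_0 Y0_pos by (cases "first_zero y = 0") (auto simp: Z_def)
  fix u assume u: "0 \<le> u" "u < first_zero y"
  then have "u \<notin> Z"
    using cInf_lower[OF _ bdd, of u] by (auto simp: fz)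
  with u y_nonneg[of u] show "0 < y u" by (auto simp: Z_def less_le)
qed

text \<open>A positive point after the first zero lies between two neighbouring zeros, which bound
  an excursion. Conversely, since \<open>y \<alpha> = 0\<close>, an excursion that starts before
  \<alpha> also ends by \<alpha>.\<close>

lemma positivity_decomposition:
  assumes \<alpha>: "0 \<le> \<alpha>" "y \<alpha> = 0"
  shows "{u \<in> {0..\<alpha>}. 0 < y u} =
    {0..<first_zero y} \<union> (\<Union>(\<alpha>', \<beta>') \<in> {(\<alpha>', \<beta>') \<in> excursions y. \<alpha>' < \<alpha>}. {\<alpha>'<..<\<beta>'})"
    (is "?D = _ \<union> ?U")
proof (intro equalityI subsetI)
  note fz = first_zero[OF \<alpha>]
  fix u assume u: "u \<in> ?D"
  show "u \<in> {0..<first_zero y} \<union> ?U"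
  proof (cases "u < first_zero y")
    case False
    have "continuous_on {first_zero y..\<alpha>} y"
      by (rule continuous_on_subset[OF y_cont]) (use fz(1) in auto)
    then obtain p q where pq: "first_zero y \<le> p" "p < u" "u < q" "q \<le> \<alpha>" "y p = 0" "y q = 0"
      "\<And>w. p < w \<Longrightarrow> w < q \<Longrightarrow> y w \<noteq> 0"
      by (rule zeros_around[of _ _ _ u]) (use fz \<alpha> u False in auto)
    have "0 < y w" if "p < w" "w < q" for w
      using pq(7)[OF that] y_nonneg[of w] that pq fz(1) by (auto simp: less_le)
    then have "(p, q) \<in> excursions y"
      using pq fz(1) by (intro excursionI) auto
    with pq have mem: "(p, q) \<in> {(\<alpha>', \<beta>') \<in> excursions y. \<alpha>' < \<alpha>}" by auto
    have "u \<in> (case (p, q) of (\<alpha>', \<beta>') \<Rightarrow> {\<alpha>'<..<\<beta>'})" using pq by simp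
    then show ?thesis by (intro UnI2 UN_I[OF mem])
  qed (use u in auto)
next
  note fz = first_zero[OF \<alpha>]
  fix u assume "u \<in> {0..<first_zero y} \<union> ?U"
  then show "u \<in> ?D"
  proof
    assume "u \<in> {0..<first_zero y}"
    then show ?thesis using fz by auto
  next
    assume "u \<in> ?U"
    then obtain p q where pq: "(p, q) \<in> excursions y" "p < \<alpha>" "p < u" "u < q" by auto
    have "0 < y 0" using y_0 Y0_pos by simp
    note exc = excursion_endpoints[OF pq(1) this]
    have "q \<le> \<alpha>"
    proof (rule ccontr)
      assume "\<not> q \<le> \<alpha>"
      then show False using exc(5)[of \<alpha>] pq(2) \<alpha>(2) by simp
    qed
    then have "u \<le> \<alpha>" "0 \<le> u" "0 < y u"
      using exc(1) exc(5)[of u] pq(3,4) by simp_all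
    then show ?thesis by simp
  qed
qed

text \<open>Up to a null set, \<open>{0..t}\<close> is the initial piece, the earlier excursions and
  \<open>{\<alpha>..t}\<close>; \<open>LINT_limit_drift\<close> evaluates the drift integral on
  each.\<close>

lemma y_on_excursion:
  assumes exc: "(\<alpha>, \<beta>) \<in> excursions y" and t: "t \<in> {\<alpha>..\<beta>}"
  defines "J \<equiv> {(\<alpha>', \<beta>') \<in> excursions y. \<alpha>' < \<alpha>}"
  shows "(\<lambda>(\<alpha>', \<beta>'). b \<beta>' - b \<alpha>') summable_on J"
    and "y t = Y0 + (LBINT s:{0..t}. limit_drift s)
      + \<sigma> * (b (first_zero y) + (\<Sum>\<^sub>\<infinity>(\<alpha>', \<beta>')\<in>J. b \<beta>' - b \<alpha>') + (b t - b \<alpha>))"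
proof -
  have y0: "0 < y 0" using y_0 Y0_pos by simp
  have ends: "0 < \<alpha>'" "\<alpha>' < \<beta>'" "y \<alpha>' = 0" "y \<beta>' = 0" "\<And>u. \<alpha>' < u \<Longrightarrow> u < \<beta>' \<Longrightarrow> 0 < y u"
    if "(\<alpha>', \<beta>') \<in> excursions y" for \<alpha>' \<beta>'
    using excursion_endpoints[OF that y0] y_nonneg[of \<alpha>'] y_nonneg[of \<beta>'] by auto
  note \<alpha>\<beta> = ends[OF exc]
  have \<alpha>: "0 \<le> \<alpha>" using \<alpha>\<beta> by simp
  note fz = first_zero[OF \<alpha> \<alpha>\<beta>(3)]
  have t0: "0 \<le> t" using t \<alpha> by auto
  define A :: "real \<times> real \<Rightarrow> real set" where "A = (\<lambda>(\<alpha>', \<beta>'). {\<alpha>'<..<\<beta>'})"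
  define U where "U = (\<Union>I\<in>J. A I)"
  define D where "D = {u \<in> {0..\<alpha>}. 0 < y u}"
  have D: "D = {0..<first_zero y} \<union> U"
    using positivity_decomposition[OF \<alpha> \<alpha>\<beta>(3)] unfolding D_def U_def A_def J_def .
  have J: "J \<subseteq> excursions y" by (auto simp: J_def)
  have U_sets: "U \<in> sets borel"
    by (intro borel_open) (auto simp: U_def A_def)
  have int: "set_integrable lborel {0..t} limit_drift"
    using t0 by (rule limit_drift_integrable)
  have D_sub: "D \<subseteq> {0..t}" using t by (auto simp: D_def)
  have int_sub: "set_integrable lborel S limit_drift" if "S \<subseteq> {0..t}" "S \<in> sets borel" for S
    by (rule set_integrable_subset[OF int]) (use that in auto)
  have disj: "{0..<first_zero y} \<inter> U = {}"
  proof -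
    have "first_zero y \<le> \<alpha>'" if "(\<alpha>', \<beta>') \<in> J" for \<alpha>' \<beta>'
      using ends[of \<alpha>' \<beta>'] that J first_zero(2)[of \<alpha>'] by auto
    then show ?thesis by (force simp: U_def A_def)
  qed
  \<comment> \<open>\<open>y\<close> vanishes at both ends, so drift and noise balance
    exactly.\<close>
  have LINT_exc: "(LBINT u:A I. limit_drift u) = - \<sigma> * (case I of (\<alpha>', \<beta>') \<Rightarrow> b \<beta>' - b \<alpha>')"
    if "I \<in> J" for I
  proof (cases I)
    case (Pair \<alpha>' \<beta>')
    with that J have "(\<alpha>', \<beta>') \<in> excursions y" by auto
    note e = ends[OF this]
    have "(LBINT u:{\<alpha>'<..<\<beta>'}. limit_drift u) = y \<beta>' - y \<alpha>' - \<sigma> * (b \<beta>' - b \<alpha>')"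
      by (rule LINT_limit_drift) (use e in auto)
    with e Pair show ?thesis by (simp add: A_def)
  qed
  have "((\<lambda>I. LBINT u:A I. limit_drift u) has_sum (LBINT u:U. limit_drift u)) J"
    unfolding U_def
  proof (rule has_sum_set_integral)
    show "countable J" using J countable_excursions countable_subset by blast
    show "disjoint_family_on A J"
      using disjoint_family_on_mono[OF J excursions_disjoint] by (simp add: A_def)
    show "set_integrable lborel (\<Union>I\<in>J. A I) limit_drift"
      unfolding U_def[symmetric] by (intro int_sub U_sets) (use D D_sub in auto)
  qed (auto simp: A_def)
  \<comment> \<open>Rescaling turns the drift integrals into noise increments, so summability and
    the value of the sum come together.\<close>
  then have "((\<lambda>I. (- 1 / \<sigma>) * (LBINT u:A I. limit_drift u)) has_sum (- 1 / \<sigma>) * (LBINT u:U. limit_drift u)) J"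
    by (rule has_sum_cmult_right)
  also have "?this \<longleftrightarrow> ((\<lambda>(\<alpha>', \<beta>'). b \<beta>' - b \<alpha>') has_sum (- 1 / \<sigma>) * (LBINT u:U. limit_drift u)) J"
    using \<sigma>_pos by (intro has_sum_cong) (simp add: LINT_exc)
  finally have sum: "((\<lambda>(\<alpha>', \<beta>'). b \<beta>' - b \<alpha>') has_sum (- 1 / \<sigma>) * (LBINT u:U. limit_drift u)) J" .
  then show "(\<lambda>(\<alpha>', \<beta>'). b \<beta>' - b \<alpha>') summable_on J"
    by (rule has_sum_imp_summable)
  have sum': "\<sigma> * (\<Sum>\<^sub>\<infinity>(\<alpha>', \<beta>')\<in>J. b \<beta>' - b \<alpha>') = - (LBINT u:U. limit_drift u)"
    using infsumI[OF sum] \<sigma>_pos by simp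
  have D_int: "set_integrable lborel D limit_drift"
    unfolding D by (rule int_sub) (use U_sets D D_sub in auto)
  have tail_int: "set_integrable lborel {\<alpha>..t} limit_drift"
    by (rule int_sub) (use \<alpha> in auto)
  \<comment> \<open>The union misses only zeros of \<open>y\<close> before \<alpha>, a null
    set.\<close>
  have "AE u in lborel. u \<in> D \<union> {\<alpha>..t} \<longleftrightarrow> u \<in> {0..t}"
    using AE_y_pos[OF t0] by eventually_elim (use t \<alpha> in \<open>auto simp: D_def\<close>)
  then have "(LBINT u:{0..t}. limit_drift u) = (LBINT u:D \<union> {\<alpha>..t}. limit_drift u)"
    using set_integrable_Un[OF D_int tail_int] int U_sets
    by (intro set_integral_cong_set)
       (auto simp: D set_borel_measurable_def set_integrable_def borel_measurable_integrable)
  also have "\<dots> = (LBINT u:D. limit_drift u) + (LBINT u:{\<alpha>..t}. limit_drift u)"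
    by (rule set_integral_Un[OF _ D_int tail_int]) (use \<alpha>\<beta>(3) in \<open>auto simp: D_def\<close>)
  also have "(LBINT u:D. limit_drift u) = (LBINT u:{0..<first_zero y}. limit_drift u) + (LBINT u:U. limit_drift u)"
    unfolding D by (rule set_integral_Un[OF disj]; rule int_sub) (use D D_sub U_sets in auto)
  also have "(LBINT u:{0..<first_zero y}. limit_drift u) = y (first_zero y) - y 0 - \<sigma> * (b (first_zero y) - b 0)"
    by (rule LINT_limit_drift) (use fz in auto)
  also have "(LBINT u:{\<alpha>..t}. limit_drift u) = y t - y \<alpha> - \<sigma> * (b t - b \<alpha>)"
    by (rule LINT_limit_drift) (use \<alpha>\<beta> t in auto)
  finally have "(LBINT u:{0..t}. limit_drift u) =
      - Y0 - \<sigma> * b (first_zero y) + (LBINT u:U. limit_drift u) + (y t - \<sigma> * (b t - b \<alpha>))"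
    using fz(3) y_0 b_0 \<alpha>\<beta>(3) by simp
  with sum' show "y t = Y0 + (LBINT s:{0..t}. limit_drift s)
      + \<sigma> * (b (first_zero y) + (\<Sum>\<^sub>\<infinity>(\<alpha>', \<beta>')\<in>J. b \<beta>' - b \<alpha>') + (b t - b \<alpha>))"
    by (simp add: algebra_simps)
qed

end

section \<open>Transfer to the sample paths\<close>

theorem mainTheorem6:
  fixes M :: "'a measure"
    and H Y0 k a \<sigma> :: real
    and B :: "real \<Rightarrow> 'a \<Rightarrow> real"
    and Ye :: "real \<Rightarrow> real \<Rightarrow> 'a \<Rightarrow> real"
    and Y :: "real \<Rightarrow> 'a \<Rightarrow> real"
  assumes "prob_space M"
    and "0 < H" and "H < 1/2"
    and "0 < Y0" and "0 < k" and "0 < a" and "0 < \<sigma>"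
    and "fractional_brownian_motion M H B"
    and "\<And>\<epsilon> \<omega>. 0 < \<epsilon> \<Longrightarrow> \<omega> \<in> space M \<Longrightarrow>
           solves_approx Y0 k a \<sigma> (\<lambda>t. B t \<omega>) \<epsilon> (\<lambda>t. Ye \<epsilon> t \<omega>)"
    and "Y = limit_process Ye"
  shows "AE \<omega> in M.
    \<forall>(\<alpha>, \<beta>) \<in> excursions (\<lambda>s. Y s \<omega>). \<forall>t \<in> {\<alpha>..\<beta>}.
      (let J = {(\<alpha>', \<beta>') \<in> excursions (\<lambda>s. Y s \<omega>). \<alpha>' < \<alpha>};
           incr = (\<lambda>(\<alpha>', \<beta>'). B \<beta>' \<omega> - B \<alpha>' \<omega>)
       in set_integrable lborel {0..t} (\<lambda>s. k / Y s \<omega> - a * Y s \<omega>) \<and>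
          incr summable_on J \<and>
          Y t \<omega> = Y0 + (LBINT s:{0..t}. k / Y s \<omega> - a * Y s \<omega>)
            + \<sigma> * (B (first_zero (\<lambda>s. Y s \<omega>)) \<omega>
                   + (\<Sum>\<^sub>\<infinity>I\<in>J. incr I)
                   + (B t \<omega> - B \<alpha> \<omega>)))"
proof (rule AE_I2)
  fix \<omega> assume \<omega>: "\<omega> \<in> space M"
  have "B 0 \<omega> = 0" "continuous_on {0..} (\<lambda>t. B t \<omega>)"
    using assms(8) \<omega> by (auto simp: fractional_brownian_motion_def)
  \<comment> \<open>The exceptional null set is empty: every sample point yields an instance of the
    deterministic setting.\<close>
  then interpret singular_limit Y0 k a \<sigma> "\<lambda>t. B t \<omega>" "\<lambda>\<epsilon> t. Ye \<epsilon> t \<omega>"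
    using assms \<omega> by unfold_locales auto
  have Y: "(\<lambda>s. Y s \<omega>) = y"
    by (simp add: assms(10) limit_process_def y_def fun_eq_iff)
  then have Y': "Y s \<omega> = y s" for s by (rule fun_cong)
  have int: "set_integrable lborel {0..t} (\<lambda>s. k / y s - a * y s)"
    if "(\<alpha>, \<beta>) \<in> excursions y" "t \<in> {\<alpha>..\<beta>}" for \<alpha> \<beta> t
    using limit_drift_integrable[of t] excursion_endpoints(1)[OF that(1)] y_0 Y0_pos that(2)
    by (simp add: limit_drift_def[abs_def])
  show "\<forall>(\<alpha>, \<beta>) \<in> excursions (\<lambda>s. Y s \<omega>). \<forall>t \<in> {\<alpha>..\<beta>}.
      (let J = {(\<alpha>', \<beta>') \<in> excursions (\<lambda>s. Y s \<omega>). \<alpha>' < \<alpha>};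
           incr = (\<lambda>(\<alpha>', \<beta>'). B \<beta>' \<omega> - B \<alpha>' \<omega>)
       in set_integrable lborel {0..t} (\<lambda>s. k / Y s \<omega> - a * Y s \<omega>) \<and>
          incr summable_on J \<and>
          Y t \<omega> = Y0 + (LBINT s:{0..t}. k / Y s \<omega> - a * Y s \<omega>)
            + \<sigma> * (B (first_zero (\<lambda>s. Y s \<omega>)) \<omega>
                   + (\<Sum>\<^sub>\<infinity>I\<in>J. incr I)
                   + (B t \<omega> - B \<alpha> \<omega>)))"
    unfolding Y Y' Let_def
    using int y_on_excursion[unfolded limit_drift_def] by blast
qed

end
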